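(* Let $n=2m$ and let $f$ be a bent function on $\mathbb{F}_2^{n}=\mathbb{F}_2^{m-1}\times\mathbb{F}_2^{m+1}$ defined by $f(x,y)=x\cdot\phi(y)+h(y)$, $x\in\mathbb{F}_2^{m-1}$, $y\in\mathbb{F}_2^{m+1}$, where $\phi\colon\mathbb{F}_2^{m+1}\to\mathbb{F}_2^{m-1}$ and $h\colon\mathbb{F}_2^{m+1}\to\mathbb{F}_2$. Assume that there exists a non-zero element $v\in\mathbb{F}_2^{m+1}$ such that, for all $z\in\mathbb{F}_2^{m-1}$, we have $v\in w_z+\phi^{-1}(z)$ for some $w_z\in\phi^{-1}(z)$. Then $f$ belongs to the completed Maiorana-McFarland class $\mathcal{M}^{\#}$.
   Context: $m$ is a positive integer, "$\cdot$" is the standard dot product over $\mathbb{F}_2$, $\phi^{-1}(z)=\{y\in\mathbb{F}_2^{m+1}\mid\phi(y)=z\}$, and $w+S=\{w+s\mid s\in S\}$. For $f\colon\mathbb{F}_2^n\to\mathbb{F}_2$, $W_f(\omega)=\sum_{x\in\mathbb{F}_2^n}(-1)^{f(x)+\omega\cdot x}$. For $n$ even, $f$ is bent if $W_f(\omega)=\pm2^{n/2}$ for all $\omega\in\mathbb{F}_2^n$. The Maiorana-McFarland class $\mathcal{M}$ in $n=2m$ variables is the set of functions $f(x,y)=x\cdot\pi(y)+g(y)$, $x,y\in\mathbb{F}_2^{m}$, with $\pi$ a permutation of $\mathbb{F}_2^{m}$ and $g$ an arbitrary Boolean function on $\mathbb{F}_2^m$. The completed class $\mathcal{M}^{\#}$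 is the set of all functions $z\mapsto f(zA+b)+c\cdot z+d$ with $f\in\mathcal{M}$, $A\in GL(n,\mathbb{F}_2)$, $b,c\in\mathbb{F}_2^n$, $d\in\mathbb{F}_2$. *)

theory Defs
  imports "HOL-Library.Z2" "Jordan_Normal_Form.Matrix"
begin

text \<open>
  Elements of \<open>\<bbbF>\<^sub>2\<^sup>n\<close> are vectors over the type \<^typ>\<open>bit\<close> whose dimension is \<open>n\<close>.  A function on
  \<open>\<bbbF>\<^sub>2\<^sup>n\<close> is a total function on \<^typ>\<open>bit vec\<close>, of which only the values on \<open>\<bbbF>\<^sub>2\<^sup>n\<close> matter; every
  notion below depends on those values only.
\<close>

abbreviation F2 :: "nat \<Rightarrow> bit vec set"
  where "F2 n \<equiv> carrier_vec n"

lemma finite_F2: "finite (F2 n)"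
proof -
  have "F2 n \<subseteq> vec_of_list ` {xs. set xs \<subseteq> UNIV \<and> length xs = n}"
  proof
    fix v :: "bit vec"
    assume "v \<in> F2 n"
    then have "v = vec_of_list (list_of_vec v)" "length (list_of_vec v) = n"
      by (auto simp: vec_list)
    then show "v \<in> vec_of_list ` {xs. set xs \<subseteq> UNIV \<and> length xs = n}"
      by blast
  qed
  moreover have "finite (UNIV :: bit set)"
    by (rule finite_subset[of _ "{0, 1}"]) (use bit.exhaust in auto)
  then have "finite {xs :: bit list. set xs \<subseteq> UNIV \<and> length xs = n}"
    by (rule finite_lists_length_eq)
  ultimately show ?thesis
    using finite_surj by blast
qed

text \<open>\<open>(-1)\<^sup>b\<close> for \<open>b \<in> \<bbbF>\<^sub>2\<close>.\<close>

definition sign_bit :: "bit \<Rightarrow> int"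
  where "sign_bit b = (if b = 0 then 1 else - 1)"

definition walsh :: "nat \<Rightarrow> (bit vec \<Rightarrow> bit) \<Rightarrow> bit vec \<Rightarrow> int"
  where "walsh n f \<omega> = (\<Sum>x\<in>F2 n. sign_bit (f x + \<omega> \<bullet> x))"

definition bent :: "nat \<Rightarrow> (bit vec \<Rightarrow> bit) \<Rightarrow> bool"
  where "bent n f \<longleftrightarrow>
    even n \<and> (\<forall>\<omega>\<in>F2 n. walsh n f \<omega> = 2 ^ (n div 2) \<or> walsh n f \<omega> = - (2 ^ (n div 2)))"

definition GL :: "nat \<Rightarrow> bit mat set"
  where "GL n = {A \<in> carrier_mat n n. invertible_mat A}"

text \<open>The class \<open>\<M>\<close> in \<open>2m\<close> variables; the concatenation of \<open>x\<close> and \<open>y\<close> stands for \<open>(x, y)\<close>.\<close>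

definition MM :: "nat \<Rightarrow> (bit vec \<Rightarrow> bit) set"
  where "MM m = {f. \<exists>(\<pi> :: bit vec \<Rightarrow> bit vec) (g :: bit vec \<Rightarrow> bit).
    bij_betw \<pi> (F2 m) (F2 m) \<and>
    (\<forall>x\<in>F2 m. \<forall>y\<in>F2 m. f (x @\<^sub>v y) = x \<bullet> \<pi> y + g y)}"

text \<open>
  The completed class \<open>\<M>\<^sup>#\<close> in \<open>2m\<close> variables.  The library's vectors are column vectors, so the
  product \<open>z A\<close> of a row vector with a matrix is written as \<open>A\<^sup>T z\<close>.
\<close>

definition MM_completed :: "nat \<Rightarrow> (bit vec \<Rightarrow> bit) set"
  where "MM_completed m = {f'. \<exists>f\<in>MM m. \<exists>A\<in>GL (2 * m). \<exists>b\<in>F2 (2 * m). \<exists>c\<in>F2 (2 * m). \<exists>d.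
    \<forall>z\<in>F2 (2 * m). f' z = f (transpose_mat A *\<^sub>v z + b) + c \<bullet> z + d}"

definition fibre :: "nat \<Rightarrow> (bit vec \<Rightarrow> bit vec) \<Rightarrow> bit vec \<Rightarrow> bit vec set"
  where "fibre k \<phi> z = {y \<in> F2 k. \<phi> y = z}"

end

theory Submission
  imports Defs "Jordan_Normal_Form.Gauss_Jordan_Elimination"
begin

text \<open>
  Bentness makes every sum \<open>\<Sum>y\<in>\<phi>\<^sup>-\<^sup>1(z). (-1)\<^bsup>h(y) + b\<cdot>y\<^esup>\<close> equal to \<open>\<plusminus>2\<close>.  A flat spectrum means a vanishing
  autocorrelation, so each fibre has four elements, and if \<open>v \<noteq> 0\<close> is a difference of two elements of
  the fibre then the signs \<open>(-1)\<^bsup>h(y) + h(y + v)\<^esup>\<close> cancel over the pairs with difference \<open>v\<close>.  As a pair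
  \<open>y, y + v\<close> contributes the same sign twice, the fibre is a union of two cosets of \<open>{0, v}\<close> on which
  the derivative \<open>D\<^sub>v h(y) = h(y) + h(y + v)\<close> takes different values.  Hence \<open>\<phi>\<close> is \<open>v\<close>-periodic, and on a
  complement \<open>C\<close> of \<open>{0, v}\<close> the map \<open>y \<mapsto> (\<phi>(y), D\<^sub>v h(y))\<close> is a bijection onto \<open>\<bbbF>\<^sub>2\<^sup>m\<close>.  Since
  \<open>f(x, y + t v) = x\<cdot>\<phi>(y) + t D\<^sub>v h(y) + h(y)\<close>, a linear change of variables moving the coordinate \<open>t\<close>
  to the \<open>x\<close>-part puts \<open>f\<close> into \<open>\<M>\<close>.
\<close>

text \<open>These rules would rewrite the field operations of \<^typ>\<open>bit\<close> to bitwise operations.\<close>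

declare add_bit_eq_xor [simp del] mult_bit_eq_and [simp del]

section \<open>Vector arithmetic in characteristic two\<close>

lemma bit_vec_add_self:
  fixes x :: "bit vec"
  assumes "x \<in> F2 n" shows "x + x = 0\<^sub>v n"
  using assms by (intro eq_vecI) (auto simp flip: mult_2)

lemma bit_vec_add_cancel:
  fixes x y :: "bit vec"
  assumes "x \<in> F2 n" "y \<in> F2 n" shows "(x + y) + y = x"
  using assms bit_vec_add_self[of y n] by (simp add: assoc_add_vec)

lemma bit_vec_add_eq_0_iff:
  fixes x y :: "bit vec"
  assumes "x \<in> F2 n" "y \<in> F2 n" shows "x + y = 0\<^sub>v n \<longleftrightarrow> x = y"
proof
  assume "x + y = 0\<^sub>v n"
  then have "0\<^sub>v n + y = x" using bit_vec_add_cancel[OF assms] by simp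
  then show "x = y" using assms(2) by simp
next
  assume "x = y"
  then show "x + y = 0\<^sub>v n" using bit_vec_add_self[OF assms(2)] by simp
qed

section \<open>Signs, character sums and autocorrelation\<close>

lemma sign_bit_add: "sign_bit (a + b) = sign_bit a * sign_bit b"
  by (cases a; cases b) (auto simp: sign_bit_def)

lemma bij_betw_add_F2: "u \<in> F2 n \<Longrightarrow> bij_betw (\<lambda>x. x + u) (F2 n) (F2 n)"
  by (rule bij_betw_byWitness[of _ "\<lambda>x. x + u"]) (auto simp: bit_vec_add_cancel)

lemma card_F2: "card (F2 n) = 2 ^ n"
proof -
  have U: "(UNIV :: bit set) = {0, 1}"
    using bit.exhaust by auto
  have "bij_betw list_of_vec (F2 n) {xs. set xs \<subseteq> UNIV \<and> length xs = n}"
    by (rule bij_betw_byWitness[of _ vec_of_list]) (auto simp: vec_list list_vec intro: carrier_vecI)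
  then have "card (F2 n) = card {xs :: bit list. set xs \<subseteq> UNIV \<and> length xs = n}"
    by (rule bij_betw_same_card)
  also have "\<dots> = 2 ^ n"
    unfolding U by (subst card_lists_length_eq) (auto simp: numeral_2_eq_2)
  finally show ?thesis .
qed

text \<open>Orthogonality of characters: if \<open>a\<close> has a non-zero coordinate
  \<open>i\<close>, translation by \<open>unit_vec n i\<close> permutes the domain and flips every
  sign, so the sum equals its own negative.\<close>

lemma sum_sign_scalar_prod:
  assumes a: "a \<in> F2 n"
  shows "(\<Sum>x\<in>F2 n. sign_bit (x \<bullet> a)) = (if a = 0\<^sub>v n then 2 ^ n else 0)"
proof (cases "a = 0\<^sub>v n")
  case True
  then show ?thesis by (simp add: sign_bit_def card_F2)
next
  case False
  then obtain i where i: "i < n" "a $ i \<noteq> 0"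
    using a by (metis carrier_vecD eq_vecI index_zero_vec)
  let ?S = "\<Sum>x\<in>F2 n. sign_bit (x \<bullet> a)"
  have "?S = (\<Sum>x\<in>F2 n. sign_bit ((x + unit_vec n i) \<bullet> a))"
    by (rule sum.reindex_bij_betw[OF bij_betw_add_F2, symmetric]) simp
  also have "\<dots> = (\<Sum>x\<in>F2 n. - sign_bit (x \<bullet> a))"
  proof (rule sum.cong)
    fix x :: "bit vec" assume "x \<in> F2 n"
    then have "(x + unit_vec n i) \<bullet> a = x \<bullet> a + 1"
      using a i by (simp add: add_scalar_prod_distrib[of _ n])
    then show "sign_bit ((x + unit_vec n i) \<bullet> a) = - sign_bit (x \<bullet> a)"
      by (simp only: sign_bit_add) (simp add: sign_bit_def)
  qed simp
  finally show ?thesis using False by (simp add: sum_negf)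
qed

text \<open>A Wiener-Khinchin argument restricted to \<open>S\<close>: weight the squared sums by
  the character \<open>sign_bit (b \<bullet> u)\<close> and sum over \<open>b\<close>. Orthogonality
  keeps only the pairs with difference \<open>u\<close>, while constancy of the squares leaves a
  bare character sum in \<open>u\<close>.\<close>

lemma autocorrelation_of_flat_spectrum:
  assumes S: "S \<subseteq> F2 n"
    and flat: "\<And>b. b \<in> F2 n \<Longrightarrow> (\<Sum>y\<in>S. sign_bit (h y + b \<bullet> y))\<^sup>2 = c"
    and u: "u \<in> F2 n"
  shows "(\<Sum>y\<in>{y\<in>S. y + u \<in> S}. sign_bit (h y + h (y + u))) = (if u = 0\<^sub>v n then c else 0)"
proof -
  have fin: "finite S" using S finite_F2 finite_subset by blast
  define T where "T b = (\<Sum>y\<in>S. sign_bit (h y + b \<bullet> y))" for b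
  define R where "R = (\<Sum>y\<in>{y\<in>S. y + u \<in> S}. sign_bit (h y + h (y + u)))"
  have "(\<Sum>b\<in>F2 n. (T b)\<^sup>2 * sign_bit (b \<bullet> u)) = (\<Sum>b\<in>F2 n. \<Sum>y\<in>S. \<Sum>y'\<in>S.
     sign_bit (h y + h y') * sign_bit (b \<bullet> (y + u + y')))"
  proof (rule sum.cong)
    fix b :: "bit vec" assume b: "b \<in> F2 n"
    have "(T b)\<^sup>2 * sign_bit (b \<bullet> u) = (\<Sum>y\<in>S. \<Sum>y'\<in>S.
        sign_bit (h y + b \<bullet> y) * sign_bit (h y' + b \<bullet> y') * sign_bit (b \<bullet> u))"
      by (simp only: T_def power2_eq_square sum_product) (simp only: sum_distrib_right)
    also have "\<dots> = (\<Sum>y\<in>S. \<Sum>y'\<in>S. sign_bit (h y + h y') * sign_bit (b \<bullet> (y + u + y')))"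
    proof (intro sum.cong refl)
      fix y y' assume "y \<in> S" "y' \<in> S"
      then have "b \<bullet> (y + u + y') = b \<bullet> y + b \<bullet> u + b \<bullet> y'"
        using S b u by (auto simp: scalar_prod_add_distrib[of _ n] subset_iff)
      then show "sign_bit (h y + b \<bullet> y) * sign_bit (h y' + b \<bullet> y') * sign_bit (b \<bullet> u)
          = sign_bit (h y + h y') * sign_bit (b \<bullet> (y + u + y'))"
        by (simp only: sign_bit_add) (simp add: ac_simps)
    qed
    finally show "(T b)\<^sup>2 * sign_bit (b \<bullet> u) = \<dots>" .
  qed simp
  also have "\<dots> = (\<Sum>y\<in>S. \<Sum>y'\<in>S. sign_bit (h y + h y') * (\<Sum>b\<in>F2 n. sign_bit (b \<bullet> (y + u + y'))))"
    by (subst sum.swap, rule sum.cong[OF refl], subst sum.swap) (simp add: sum_distrib_left)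
  also have "\<dots> = (\<Sum>y\<in>S. \<Sum>y'\<in>S. if y' = y + u then 2 ^ n * sign_bit (h y + h y') else 0)"
  proof (intro sum.cong refl)
    fix y y' assume "y \<in> S" "y' \<in> S"
    then have "y \<in> F2 n" "y' \<in> F2 n" using S by auto
    then show "sign_bit (h y + h y') * (\<Sum>b\<in>F2 n. sign_bit (b \<bullet> (y + u + y')))
        = (if y' = y + u then 2 ^ n * sign_bit (h y + h y') else 0)"
      using u by (auto simp: sum_sign_scalar_prod bit_vec_add_eq_0_iff)
  qed
  also have "\<dots> = (\<Sum>y\<in>S. if y + u \<in> S then 2 ^ n * sign_bit (h y + h (y + u)) else 0)"
    using fin by (intro sum.cong refl) (simp add: sum.delta)
  also have "\<dots> = 2 ^ n * R"
    using fin by (simp add: R_def sum_distrib_left sum.If_cases Int_def)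
  finally have "2 ^ n * R = (\<Sum>b\<in>F2 n. c * sign_bit (b \<bullet> u))"
    using flat by (simp add: T_def)
  also have "\<dots> = 2 ^ n * (if u = 0\<^sub>v n then c else 0)"
    using u by (simp add: sum_sign_scalar_prod flip: sum_distrib_left)
  finally show ?thesis by (simp add: R_def)
qed

section \<open>Walsh values as sums over fibres\<close>

lemma sum_F2_append:
  "(\<Sum>z\<in>F2 (k + l). F z) = (\<Sum>x\<in>F2 k. \<Sum>y\<in>F2 l. F (x @\<^sub>v y))"
proof -
  have "bij_betw (\<lambda>(x, y). x @\<^sub>v y) (F2 k \<times> F2 l) (F2 (k + l))"
  proof (rule bij_betw_imageI)
    show "inj_on (\<lambda>(x, y). x @\<^sub>v y) (F2 k \<times> F2 l)"
      by (auto simp: inj_on_def)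
    show "(\<lambda>(x, y). x @\<^sub>v y) ` (F2 k \<times> F2 l) = F2 (k + l)"
      by (auto simp: image_iff) (metis vec_first_last_append vec_first_carrier vec_last_carrier)
  qed
  from sum.reindex_bij_betw[OF this, of F, symmetric] show ?thesis
    by (simp add: sum.cartesian_product case_prod_unfold)
qed

text \<open>Summing over \<open>x\<close> first gives a character sum at
  \<open>\<phi> y + a\<close>, which vanishes unless \<open>y\<close> lies in the fibre over
  \<open>a\<close>.\<close>

lemma walsh_append:
  assumes \<phi>: "\<phi> \<in> F2 l \<rightarrow> F2 k"
    and f: "\<And>x y. x \<in> F2 k \<Longrightarrow> y \<in> F2 l \<Longrightarrow> f (x @\<^sub>v y) = x \<bullet> \<phi> y + h y"
    and a: "a \<in> F2 k" and b: "b \<in> F2 l"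
  shows "walsh (k + l) f (a @\<^sub>v b) = 2 ^ k * (\<Sum>y\<in>fibre l \<phi> a. sign_bit (h y + b \<bullet> y))"
proof -
  have "walsh (k + l) f (a @\<^sub>v b)
      = (\<Sum>y\<in>F2 l. \<Sum>x\<in>F2 k. sign_bit (f (x @\<^sub>v y) + (a @\<^sub>v b) \<bullet> (x @\<^sub>v y)))"
    unfolding walsh_def sum_F2_append by (rule sum.swap)
  also have "\<dots> = (\<Sum>y\<in>F2 l. \<Sum>x\<in>F2 k. sign_bit (h y + b \<bullet> y) * sign_bit (x \<bullet> (\<phi> y + a)))"
  proof (intro sum.cong refl)
    fix x y :: "bit vec" assume xy: "x \<in> F2 k" "y \<in> F2 l"
    then have py: "\<phi> y \<in> F2 k" using \<phi> by auto
    have "(a @\<^sub>v b) \<bullet> (x @\<^sub>v y) = x \<bullet> a + b \<bullet> y"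
      using xy a b by (simp add: scalar_prod_append comm_scalar_prod[of a k])
    moreover have "x \<bullet> (\<phi> y + a) = x \<bullet> \<phi> y + x \<bullet> a"
      using xy a py by (simp add: scalar_prod_add_distrib)
    ultimately show "sign_bit (f (x @\<^sub>v y) + (a @\<^sub>v b) \<bullet> (x @\<^sub>v y))
        = sign_bit (h y + b \<bullet> y) * sign_bit (x \<bullet> (\<phi> y + a))"
      by (simp only: f[OF xy] sign_bit_add) (simp add: ac_simps)
  qed
  also have "\<dots> = (\<Sum>y\<in>F2 l. if \<phi> y = a then 2 ^ k * sign_bit (h y + b \<bullet> y) else 0)"
  proof (rule sum.cong)
    fix y :: "bit vec" assume "y \<in> F2 l"
    then have "\<phi> y \<in> F2 k" using \<phi> by auto
    then show "(\<Sum>x\<in>F2 k. sign_bit (h y + b \<bullet> y) * sign_bit (x \<bullet> (\<phi> y + a)))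
        = (if \<phi> y = a then 2 ^ k * sign_bit (h y + b \<bullet> y) else 0)"
      using a by (simp add: sum_sign_scalar_prod bit_vec_add_eq_0_iff flip: sum_distrib_left)
  qed simp
  also have "\<dots> = 2 ^ k * (\<Sum>y\<in>fibre l \<phi> a. sign_bit (h y + b \<bullet> y))"
    by (simp add: fibre_def sum_distrib_left sum.If_cases Int_def finite_F2)
  finally show ?thesis .
qed

text \<open>The Walsh values are plus or minus \<open>2 ^ (k + 1)\<close>; cancelling the factor
  \<open>2 ^ k\<close> leaves fibre sums of plus or minus 2, a flat spectrum with square 4.\<close>

lemma fibre_autocorrelation:
  assumes bent: "bent (k + (k + 2)) f"
    and \<phi>: "\<phi> \<in> F2 (k + 2) \<rightarrow> F2 k"
    and f: "\<And>x y. x \<in> F2 k \<Longrightarrow> y \<in> F2 (k + 2) \<Longrightarrow> f (x @\<^sub>v y) = x \<bullet> \<phi> y + h y"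
    and a: "a \<in> F2 k" and u: "u \<in> F2 (k + 2)"
  shows "(\<Sum>y\<in>{y\<in>fibre (k + 2) \<phi> a. y + u \<in> fibre (k + 2) \<phi> a}. sign_bit (h y + h (y + u)))
    = (if u = 0\<^sub>v (k + 2) then 4 else 0)"
proof (rule autocorrelation_of_flat_spectrum[OF _ _ u])
  show "fibre (k + 2) \<phi> a \<subseteq> F2 (k + 2)" by (auto simp: fibre_def)
  fix b assume b: "b \<in> F2 (k + 2)"
  define T where "T = (\<Sum>y\<in>fibre (k + 2) \<phi> a. sign_bit (h y + b \<bullet> y))"
  have half: "(k + (k + 2)) div 2 = k + 1" by simp
  have "a @\<^sub>v b \<in> F2 (k + (k + 2))" using a b by (rule append_carrier_vec)
  then have "2 ^ k * T = 2 ^ (k + 1) \<or> 2 ^ k * T = - (2 ^ (k + 1))"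
    using bent walsh_append[OF \<phi> f a b] unfolding bent_def half T_def by metis
  then have "2 ^ k * T = 2 ^ k * 2 \<or> 2 ^ k * T = 2 ^ k * (- 2)"
    by (simp only: power_add power_one_right mult_minus_right)
  then have "T = 2 \<or> T = - 2"
    by (metis mult_cancel_left power_not_zero zero_neq_numeral)
  then show "T\<^sup>2 = 4" by auto
qed

section \<open>Invertible matrices and linear changes of variables\<close>

lemma square_mat_inverse_mult:
  fixes A B A' B' :: "'a :: semiring_1 mat"
  assumes carr: "A \<in> carrier_mat n n" "B \<in> carrier_mat n n"
      "B' \<in> carrier_mat n n" "A' \<in> carrier_mat n n"
    and "A * A' = 1\<^sub>m n" "B * B' = 1\<^sub>m n"
  shows "(A * B) * (B' * A') = 1\<^sub>m n"
proof -
  have "(A * B) * (B' * A') = A * (B * (B' * A'))"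
    using carr by (intro assoc_mult_mat) auto
  also have "B * (B' * A') = (B * B') * A'"
    using carr by (intro assoc_mult_mat[symmetric]) auto
  finally show ?thesis using assms left_mult_one_mat[OF carr(4)] by simp
qed

text \<open>Pick \<open>k\<close> with \<open>v $ k = 1\<close>. The identity with column
  \<open>k\<close> replaced by \<open>v\<close> is then an involution \<open>E\<close>, and the swap
  of coordinates 0 and \<open>k\<close> is an involution \<open>?P\<close>, so \<open>E * ?P\<close>
  and \<open>?P * E\<close> are mutually inverse.\<close>

lemma inverse_pair_with_first_col:
  fixes v :: "bit vec"
  assumes v: "v \<in> F2 n" and v0: "v \<noteq> 0\<^sub>v n"
  obtains M N where "M \<in> carrier_mat n n" "N \<in> carrier_mat n n" "M * N = 1\<^sub>m n" "N * M = 1\<^sub>m n"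
    "M *\<^sub>v unit_vec n 0 = v"
proof -
  obtain k where k: "k < n" "v $ k \<noteq> 0"
    using v v0 by (metis carrier_vecD eq_vecI index_zero_vec)
  let ?P = "swaprows_mat n 0 k :: bit mat"
  define E :: "bit mat" where
    "E = mat n n (\<lambda>(i, j). if j = k then v $ i else if i = j then 1 else 0)"
  have carr: "?P \<in> carrier_mat n n" "E \<in> carrier_mat n n"
    by (auto simp: E_def)
  have PP: "?P * ?P = 1\<^sub>m n"
    using k by (intro swaprows_mat_inv) auto
  have EE: "E * E = 1\<^sub>m n"
  proof (rule eq_matI)
    fix i j assume ij: "i < dim_row (1\<^sub>m n :: bit mat)" "j < dim_col (1\<^sub>m n :: bit mat)"
    have "(E * E) $$ (i, j) = (\<Sum>l\<in>{0..<n}. E $$ (i, l) * E $$ (l, j))"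
      using ij by (simp add: E_def scalar_prod_def)
    also have "\<dots> = (\<Sum>l\<in>{0..<n} - {k}. E $$ (i, l) * E $$ (l, j)) + E $$ (i, k) * E $$ (k, j)"
      using k by (subst sum.remove[of _ k]) (auto simp: add.commute)
    also have "(\<Sum>l\<in>{0..<n} - {k}. E $$ (i, l) * E $$ (l, j))
        = (\<Sum>l\<in>{0..<n} - {k}. if l = i then E $$ (i, j) else 0)"
      using ij by (intro sum.cong) (auto simp: E_def)
    also have "\<dots> = (if i = k then 0 else E $$ (i, j))"
      using ij by (simp add: sum.delta)
    \<comment> \<open>The critical entries are those with \<open>j = k\<close> and
      \<open>i \<noteq> k\<close>: both summands equal \<open>v $ i\<close> and cancel in
      characteristic two.\<close>
    also have "\<dots> + E $$ (i, k) * E $$ (k, j) = (1\<^sub>m n) $$ (i, j)"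
      using ij k by (auto simp: E_def simp flip: mult_2)
    finally show "(E * E) $$ (i, j) = (1\<^sub>m n) $$ (i, j)" .
  qed (auto simp: E_def)
  have col: "?P *\<^sub>v unit_vec n 0 = unit_vec n k"
    using k by (intro eq_vecI) (auto simp: swaprows_mat_def)
  have "E *\<^sub>v unit_vec n k = v"
    using k v by (intro eq_vecI) (auto simp: E_def)
  then have "(E * ?P) *\<^sub>v unit_vec n 0 = v"
    using carr col by (simp add: assoc_mult_mat_vec[of _ n n _ n])
  moreover have "(E * ?P) * (?P * E) = 1\<^sub>m n"
    using square_mat_inverse_mult[OF carr(2,1,1,2) EE PP] .
  moreover have "(?P * E) * (E * ?P) = 1\<^sub>m n"
    using square_mat_inverse_mult[OF carr(1,2,2,1) PP EE] .
  ultimately show ?thesis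
    using that[of "E * ?P" "?P * E"] mult_carrier_mat[OF carr(2,1)] mult_carrier_mat[OF carr(1,2)]
    by simp
qed

text \<open>The shift, the linear term and the constant are taken to be zero. The matrix witness is
  \<open>B\<^sup>T\<close>, because the class is defined through a transpose.\<close>

lemma MM_completedI:
  assumes f0: "f0 \<in> MM m"
    and carr: "B \<in> carrier_mat (2 * m) (2 * m)" "B' \<in> carrier_mat (2 * m) (2 * m)"
    and inv: "B * B' = 1\<^sub>m (2 * m)" "B' * B = 1\<^sub>m (2 * m)"
    and f: "\<And>z. z \<in> F2 (2 * m) \<Longrightarrow> f z = f0 (B *\<^sub>v z)"
  shows "f \<in> MM_completed m"
proof -
  have "B\<^sup>T * B'\<^sup>T = 1\<^sub>m (2 * m)" "B'\<^sup>T * B\<^sup>T = 1\<^sub>m (2 * m)"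
    using inv by (simp_all flip: transpose_mult[OF carr] transpose_mult[OF carr(2,1)])
  then have "B\<^sup>T \<in> GL (2 * m)"
    using carr by (auto simp: GL_def invertible_mat_def inverts_mat_def)
  moreover have "\<forall>z\<in>F2 (2 * m). f z = f0 (B\<^sup>T\<^sup>T *\<^sub>v z + 0\<^sub>v (2 * m)) + 0\<^sub>v (2 * m) \<bullet> z + 0"
    using f right_zero_vec[OF mult_mat_vec_carrier[OF carr(1)]] by simp
  ultimately show ?thesis
    using f0 unfolding MM_completed_def mem_Collect_eq
    by (intro bexI[of _ f0] bexI[of _ "B\<^sup>T"] bexI[of _ "0\<^sub>v (2 * m)"] exI[of _ 0]) auto
qed

section \<open>The structure of a fibre\<close>

text \<open>Autocorrelation at 0 shows that the fibre has four elements. At \<open>v\<close> it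
  makes signs cancel over the pairs \<open>y, y + v\<close>, so besides the pair of \<open>w\<close>
  there is one of opposite sign, and these two pairs exhaust the fibre.\<close>

lemma fibre_translate:
  assumes bent: "bent (k + (k + 2)) f"
    and \<phi>: "\<phi> \<in> F2 (k + 2) \<rightarrow> F2 k"
    and f: "\<And>x y. x \<in> F2 k \<Longrightarrow> y \<in> F2 (k + 2) \<Longrightarrow> f (x @\<^sub>v y) = x \<bullet> \<phi> y + h y"
    and a: "a \<in> F2 k" and v: "v \<in> F2 (k + 2)" "v \<noteq> 0\<^sub>v (k + 2)"
    and w: "w \<in> fibre (k + 2) \<phi> a" "w + v \<in> fibre (k + 2) \<phi> a"
  shows "\<And>y. y \<in> fibre (k + 2) \<phi> a \<Longrightarrow> y + v \<in> fibre (k + 2) \<phi> a"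
    and "\<And>y y'. \<lbrakk>y \<in> fibre (k + 2) \<phi> a; y' \<in> fibre (k + 2) \<phi> a; y' \<noteq> y; y' \<noteq> y + v\<rbrakk>
      \<Longrightarrow> h y + h (y + v) \<noteq> h y' + h (y' + v)"
proof -
  let ?F = "fibre (k + 2) \<phi> a"
  define D where "D y = h y + h (y + v)" for y
  define S where "S = {y\<in>?F. y + v \<in> ?F}"
  have F: "?F \<subseteq> F2 (k + 2)" by (auto simp: fibre_def)
  then have fin: "finite ?F" using finite_F2 finite_subset by blast
  have "(\<Sum>y\<in>{y\<in>?F. y + 0\<^sub>v (k + 2) \<in> ?F}. sign_bit (h y + h (y + 0\<^sub>v (k + 2)))) = 4"
    using fibre_autocorrelation[OF bent \<phi> f a zero_carrier_vec] by simp
  moreover have "{y\<in>?F. y + 0\<^sub>v (k + 2) \<in> ?F} = ?F" using F by auto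
  moreover have "(\<Sum>y\<in>?F. sign_bit (h y + h (y + 0\<^sub>v (k + 2)))) = (\<Sum>y\<in>?F. 1)"
    using F by (intro sum.cong) (auto simp: sign_bit_def simp flip: mult_2)
  ultimately have card: "card ?F = 4" by simp
  have sum0: "(\<Sum>y\<in>S. sign_bit (D y)) = 0"
    using fibre_autocorrelation[OF bent \<phi> f a v(1)] v(2) by (simp add: S_def D_def)
  have S: "y + v \<in> S" "y + v \<noteq> y" "(y + v) + v = y" "D (y + v) = D y" if "y \<in> S" for y
  proof -
    have y: "y \<in> F2 (k + 2)" using that F by (auto simp: S_def)
    then show yv: "(y + v) + v = y" using v(1) by (rule bit_vec_add_cancel)
    then show "y + v \<in> S" using that by (auto simp: S_def)
    show "D (y + v) = D y" by (simp add: D_def yv add.commute)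
    show "y + v \<noteq> y"
      using y v bit_vec_add_self[of y "k + 2"] bit_vec_add_cancel[of v "k + 2" y]
      by (metis comm_add_vec)
  qed
  have finS: "finite S" and SF: "S \<subseteq> ?F" using fin by (auto simp: S_def)
  have "S = ?F \<and> (\<forall>y\<in>S. \<forall>y'\<in>S. y' \<noteq> y \<longrightarrow> y' \<noteq> y + v \<longrightarrow> D y \<noteq> D y')"
  proof -
    have wS: "w \<in> S" using w by (simp add: S_def)
    \<comment> \<open>Were \<open>D\<close> constant on \<open>S\<close>, the vanishing sum would be
      plus or minus the size of \<open>S\<close>, which is positive.\<close>
    have "\<exists>y\<in>S. D y \<noteq> D w"
    proof (rule ccontr)
      assume "\<not> ?thesis"
      then have "(\<Sum>y\<in>S. sign_bit (D y)) = (\<Sum>y\<in>S. sign_bit (D w))"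
        by (intro sum.cong) auto
      moreover have "card S \<noteq> 0" using wS finS by auto
      ultimately show False using sum0 by (simp add: sign_bit_def split: if_splits)
    qed
    then obtain y where y: "y \<in> S" "D y \<noteq> D w" by blast
    have "card {w, w + v, y, y + v} = 4"
    proof -
      have "distinct [w, w + v, y, y + v]"
        using S(2,4)[OF wS] S(2,4)[OF y(1)] y(2) by (simp del: bit_not_zero_iff) metis
      then show ?thesis using distinct_card by fastforce
    qed
    moreover have sub: "{w, w + v, y, y + v} \<subseteq> S" using S(1) wS y(1) by blast
    ultimately have eq: "{w, w + v, y, y + v} = ?F"
      using card_subset_eq[OF fin subset_trans[OF sub SF]] card by metis
    then have "S = ?F" using sub SF by auto
    moreover have "D z \<noteq> D z'"
      if "z \<in> S" "z' \<in> S" "z' \<noteq> z" "z' \<noteq> z + v" for z z'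
    proof -
      have "z \<in> {w, w + v, y, y + v}" "z' \<in> {w, w + v, y, y + v}"
        using that SF unfolding eq by auto
      then show ?thesis
        \<comment> \<open>If \<open>z'\<close> is neither \<open>z\<close> nor \<open>z + v\<close>,
          the two lie in different pairs, where \<open>D\<close> differs.\<close>
        using S(3,4)[OF wS] S(3,4)[OF y(1)] y(2) that(3,4)
        by (elim insertE emptyE) simp_all
    qed
    ultimately show ?thesis by blast
  qed
  then show "\<And>y. y \<in> ?F \<Longrightarrow> y + v \<in> ?F"
    and "\<And>y y'. \<lbrakk>y \<in> ?F; y' \<in> ?F; y' \<noteq> y; y' \<noteq> y + v\<rbrakk> \<Longrightarrow> h y + h (y + v) \<noteq> h y' + h (y' + v)"
    unfolding D_def S_def by blast+
qed

section \<open>Passing to Maiorana-McFarland coordinates\<close>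

lemma vCons_eq_add_unit:
  assumes "y \<in> F2 l" shows "vCons 1 y = vCons 0 y + unit_vec (Suc l) 0"
  using assms by (intro eq_vecI) (auto simp: vec_index_vCons)

text \<open>Regrouping coordinates leaves the concatenated vector unchanged, so moving the last
  coordinate of \<open>x\<close> to the front of the second block takes no permutation
  matrix.\<close>

lemma append_vCons_move:
  assumes "x \<in> F2 (Suc k)"
  shows "x @\<^sub>v y = vec_first x k @\<^sub>v vCons (x $ k) y"
  using assms by (intro eq_vecI) (auto simp: vec_first_def vec_index_vCons less_Suc_eq not_less Suc_diff_le)

lemma bent_MM_of_translation_invariant:
  assumes bent: "bent (k + (k + 2)) f"
    and \<phi>: "\<phi> \<in> F2 (k + 2) \<rightarrow> F2 k"
    and f: "\<And>x y. x \<in> F2 k \<Longrightarrow> y \<in> F2 (k + 2) \<Longrightarrow> f (x @\<^sub>v y) = x \<bullet> \<phi> y + h y"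
    and v: "v \<in> F2 (k + 2)" "v \<noteq> 0\<^sub>v (k + 2)"
    and w: "\<And>a. a \<in> F2 k \<Longrightarrow> \<exists>w\<in>fibre (k + 2) \<phi> a. w + v \<in> fibre (k + 2) \<phi> a"
  shows "f \<in> MM_completed (Suc k)"
proof -
  have \<phi>_v: "\<phi> (y + v) = \<phi> y" if "y \<in> F2 (k + 2)" for y
    using fibre_translate(1)[OF bent \<phi> f _ v, of "\<phi> y" _ y] w[of "\<phi> y"] that \<phi>
    by (auto simp: fibre_def)
  have h_v: "h y + h (y + v) \<noteq> h y' + h (y' + v)"
    if "y \<in> F2 (k + 2)" "y' \<in> F2 (k + 2)" "\<phi> y = \<phi> y'" "y' \<noteq> y" "y' \<noteq> y + v" for y y'
    using fibre_translate(2)[OF bent \<phi> f _ v, of "\<phi> y" _ y y'] w[of "\<phi> y"] that \<phi>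
    by (auto simp: fibre_def)
  obtain M N where MN: "M \<in> carrier_mat (k + 2) (k + 2)" "N \<in> carrier_mat (k + 2) (k + 2)"
    "M * N = 1\<^sub>m (k + 2)" "N * M = 1\<^sub>m (k + 2)" and Mv: "M *\<^sub>v unit_vec (k + 2) 0 = v"
    using inverse_pair_with_first_col[OF v] .
  have M_inj: "y = y'" if "M *\<^sub>v y = M *\<^sub>v y'" "y \<in> F2 (k + 2)" "y' \<in> F2 (k + 2)" for y y'
    using that MN by (metis assoc_mult_mat_vec one_mult_mat_vec)
  \<comment> \<open>\<open>M\<close> sends the first unit vector to \<open>v\<close>, so vectors
    with first coordinate 0 are mapped onto a complement of the span of \<open>v\<close>,
    parametrised by \<open>C\<close>.\<close>
  define C where "C y = M *\<^sub>v vCons 0 y" for y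
  have C: "C y \<in> F2 (k + 2)" if "y \<in> F2 (Suc k)" for y
    using MN that by (simp add: C_def)
  have Cv: "M *\<^sub>v vCons 1 y = C y + v" if "y \<in> F2 (Suc k)" for y
    using MN that Mv
    by (simp add: C_def vCons_eq_add_unit[OF that] mult_add_distrib_mat_vec[of _ "k + 2" "k + 2"])
  have C_inj: "C y' \<noteq> C y" "C y' \<noteq> C y + v" if "y \<in> F2 (Suc k)" "y' \<in> F2 (Suc k)" "y' \<noteq> y" for y y'
  proof -
    show "C y' \<noteq> C y"
      using M_inj[of "vCons 0 y'" "vCons 0 y"] that unfolding C_def by auto
    show "C y' \<noteq> C y + v"
      using M_inj[of "vCons 0 y'" "vCons 1 y"] that Cv[OF that(1)]
      by (metis C_def Suc_eq_plus1 add_2_eq_Suc' vCons_carrier_vec vec_index_vCons_0 zero_neq_one)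
  qed
  \<comment> \<open>The derivative of \<open>h\<close> along \<open>v\<close> supplies the
    coordinate that \<open>\<phi>\<close> lacks for a permutation of dimension
    \<open>k + 1\<close>.\<close>
  define D where "D y = h (C y) + h (C y + v)" for y
  define \<pi> where "\<pi> y = \<phi> (C y) @\<^sub>v vCons (D y) vNil" for y
  have \<pi>_carr: "\<pi> y \<in> F2 (Suc k)" if "y \<in> F2 (Suc k)" for y
    using \<phi> C[OF that] append_carrier_vec[of "\<phi> (C y)" k "vCons (D y) vNil" 1]
    by (auto simp: \<pi>_def)
  have "inj_on \<pi> (F2 (Suc k))"
  proof (rule inj_onI, rule ccontr)
    fix y y' assume y: "y \<in> F2 (Suc k)" "y' \<in> F2 (Suc k)" "\<pi> y = \<pi> y'" "y \<noteq> y'"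
    have "\<phi> (C y) \<in> F2 k" "\<phi> (C y') \<in> F2 k" using \<phi> C y by auto
    then have "\<phi> (C y) = \<phi> (C y')" "vCons (D y) vNil = vCons (D y') vNil"
      using y(3) by (auto simp: \<pi>_def append_vec_eq)
    moreover from this(2) have "D y = D y'" by (metis vec_index_vCons_0)
    ultimately show False
      using h_v[of "C y" "C y'"] C C_inj[of y y'] y by (auto simp: D_def)
  qed
  then have bij: "bij_betw \<pi> (F2 (Suc k)) (F2 (Suc k))"
    using \<pi>_carr endo_inj_surj[OF finite_F2] unfolding bij_betw_def by blast
  \<comment> \<open>\<open>Q X\<close> fixes the first \<open>k\<close> coordinates and applies
    \<open>X\<close> to the others.\<close>
  define Q :: "bit mat \<Rightarrow> bit mat"
    where "Q X = four_block_mat (1\<^sub>m k) (0\<^sub>m k (k + 2)) (0\<^sub>m (k + 2) k) X" for X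
  have dim: "2 * Suc k = k + (k + 2)" by simp
  have Q: "Q X \<in> carrier_mat (2 * Suc k) (2 * Suc k)" if "X \<in> carrier_mat (k + 2) (k + 2)" for X
    unfolding dim Q_def using that by (intro four_block_carrier_mat) auto
  have Q_mult: "Q X * Q Y = Q (X * Y)"
    if "X \<in> carrier_mat (k + 2) (k + 2)" "Y \<in> carrier_mat (k + 2) (k + 2)" for X Y
    using that unfolding Q_def
    by (subst mult_four_block_mat[of _ k k _ "k + 2" _ "k + 2" _ _ k _ "k + 2"]) auto
  have Q_one: "Q (1\<^sub>m (k + 2)) = 1\<^sub>m (2 * Suc k)"
    unfolding dim Q_def by (rule four_block_one_mat)
  have Q_append: "Q X *\<^sub>v (x @\<^sub>v y) = x @\<^sub>v X *\<^sub>v y"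
    if "X \<in> carrier_mat (k + 2) (k + 2)" "x \<in> F2 k" "y \<in> F2 (k + 2)" for X x y
    using that by (simp add: Q_def mult_mat_vec_split)
  have "(\<lambda>z. f (Q M *\<^sub>v z)) \<in> MM (Suc k)"
    unfolding MM_def
  proof (intro CollectI exI conjI ballI)
    show "bij_betw \<pi> (F2 (Suc k)) (F2 (Suc k))" by (rule bij)
    fix x y :: "bit vec" assume x: "x \<in> F2 (Suc k)" and y: "y \<in> F2 (Suc k)"
    define x1 where "x1 = vec_first x k"
    have x1: "x1 \<in> F2 k" by (simp add: x1_def)
    have p: "\<phi> (C y) \<in> F2 k" using \<phi> C[OF y] by auto
    have "x @\<^sub>v vNil = x" by (intro eq_vecI) auto
    then have "x = x1 @\<^sub>v vCons (x $ k) vNil"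
      using append_vCons_move[OF x, of vNil] by (simp add: x1_def)
    then have "x \<bullet> \<pi> y = (x1 @\<^sub>v vCons (x $ k) vNil) \<bullet> (\<phi> (C y) @\<^sub>v vCons (D y) vNil)"
      by (simp add: \<pi>_def)
    also have "\<dots> = x1 \<bullet> \<phi> (C y) + x $ k * D y"
      using x1 p by (subst scalar_prod_append[of _ k _ 1]) auto
    finally have xp: "x \<bullet> \<pi> y = x1 \<bullet> \<phi> (C y) + x $ k * D y" .
    have "Q M *\<^sub>v (x @\<^sub>v y) = x1 @\<^sub>v M *\<^sub>v vCons (x $ k) y"
      using append_vCons_move[OF x, of y] MN y x1 by (simp add: Q_append x1_def)
    \<comment> \<open>The moved coordinate is the multiplier of \<open>v\<close>: the value 1
      replaces \<open>C y\<close> by \<open>C y + v\<close>, which keeps \<open>\<phi>\<close> and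
      adds \<open>D y\<close> to \<open>h\<close>.\<close>
    also have "f \<dots> = x \<bullet> \<pi> y + h (C y)"
    proof (cases "x $ k = 0")
      case True
      then show ?thesis using f[OF x1 C[OF y]] xp by (simp add: C_def)
    next
      case False
      then have 1: "x $ k = 1" by simp
      have "f (x1 @\<^sub>v (C y + v)) = x1 \<bullet> \<phi> (C y) + h (C y + v)"
        using f[OF x1, of "C y + v"] \<phi>_v[OF C[OF y]] C[OF y] v by simp
      moreover have "h (C y + v) = D y + h (C y)"
        unfolding D_def by (cases "h (C y)"; cases "h (C y + v)") auto
      ultimately show ?thesis using 1 xp Cv[OF y] by (simp add: add.assoc)
    qed
    finally show "f (Q M *\<^sub>v (x @\<^sub>v y)) = x \<bullet> \<pi> y + h (C y)" .
  qed
  then show ?thesis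
  \<comment> \<open>The function in the class is \<open>f\<close> composed with \<open>Q M\<close>,
    so \<open>f\<close> is recovered by substituting the inverse \<open>Q N\<close>.\<close>
  proof (rule MM_completedI[where B = "Q N" and B' = "Q M"])
    show inv: "Q M * Q N = 1\<^sub>m (2 * Suc k)" "Q N * Q M = 1\<^sub>m (2 * Suc k)"
      "Q M \<in> carrier_mat (2 * Suc k) (2 * Suc k)" "Q N \<in> carrier_mat (2 * Suc k) (2 * Suc k)"
      by (simp_all only: MN Q Q_mult Q_one)
    fix z :: "bit vec" assume "z \<in> F2 (2 * Suc k)"
    then have "Q M *\<^sub>v (Q N *\<^sub>v z) = z"
      using inv by (metis assoc_mult_mat_vec one_mult_mat_vec)
    then show "f z = f (Q M *\<^sub>v (Q N *\<^sub>v z))" by simp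
  qed
qed

theorem proposition4p1:
  fixes m :: nat
    and f h :: "bit vec \<Rightarrow> bit"
    and \<phi> :: "bit vec \<Rightarrow> bit vec"
  assumes "m > 0"
    and "bent (2 * m) f"
    and "\<phi> \<in> F2 (m + 1) \<rightarrow> F2 (m - 1)"
    and "\<forall>x\<in>F2 (m - 1). \<forall>y\<in>F2 (m + 1). f (x @\<^sub>v y) = x \<bullet> \<phi> y + h y"
    and "\<exists>v\<in>F2 (m + 1). v \<noteq> 0\<^sub>v (m + 1) \<and>
           (\<forall>z\<in>F2 (m - 1). \<exists>w\<in>fibre (m + 1) \<phi> z. v \<in> (\<lambda>s. w + s) ` fibre (m + 1) \<phi> z)"
  shows "f \<in> MM_completed m"
proof -
  \<comment> \<open>Writing \<open>m\<close> as a successor removes the truncated subtraction in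
    \<open>m - 1\<close>.\<close>
  obtain k where m: "m = Suc k" using assms(1) gr0_implies_Suc by blast
  have dims: "m - 1 = k" "m + 1 = k + 2" "2 * m = k + (k + 2)" by (simp_all add: m)
  obtain v where v: "v \<in> F2 (k + 2)" "v \<noteq> 0\<^sub>v (k + 2)"
    and w: "\<And>z. z \<in> F2 k \<Longrightarrow> \<exists>w\<in>fibre (k + 2) \<phi> z. v \<in> (\<lambda>s. w + s) ` fibre (k + 2) \<phi> z"
    using assms(5) unfolding dims by blast
  have "\<exists>w\<in>fibre (k + 2) \<phi> z. w + v \<in> fibre (k + 2) \<phi> z" if z: "z \<in> F2 k" for z
  proof -
    obtain w s where ws: "w \<in> fibre (k + 2) \<phi> z" "s \<in> fibre (k + 2) \<phi> z" "v = w + s"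
      using w[OF z] by blast
    then have "w \<in> F2 (k + 2)" "s \<in> F2 (k + 2)" by (auto simp: fibre_def)
    \<comment> \<open>From \<open>v = w + s\<close> the two copies of \<open>w\<close> cancel, so
      \<open>v\<close> is a difference of two fibre elements.\<close>
    then have "w + v = s"
      unfolding ws(3) by (metis add_carrier_vec bit_vec_add_cancel comm_add_vec)
    then show ?thesis using ws by blast
  qed
  then show ?thesis
    unfolding m using assms(2-4) v unfolding dims
    by (intro bent_MM_of_translation_invariant[where \<phi> = \<phi> and h = h and v = v]) auto
qed

end
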